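(* Let $A$ be an $n\times n$ nonsingular integer matrix, and let $f$ be the (projective) monomial map from $\mathbb{CP}^n$ to itself associated with $A$. Then the topological entropy of $f$ is at least $$\log\Bigl|\prod_{|\lambda|>1}\lambda\Bigr|,$$ where the product ranges over all eigenvalues $\lambda$ of $A$ (counted with algebraic multiplicity) lying outside the unit circle, the empty product being $1$.
   Context: Monomial maps. A nonsingular integer matrix $A=(a_{ij})_{i,j=1}^n$ determines the affine monomial map $(x_1,\dots,x_n)\mapsto(y_1,\dots,y_n)$, $y_i=\prod_j x_j^{a_{ij}}$, on a dense open subset of $\mathbb C^n$. Its projectivization is obtained by substituting $x_j/x_{n+1}$ for $x_j$, i.e. $(x_1:\dots:x_{n+1})\mapsto(y_1:\dots:y_n:1)$ with $y_i=\prod_j (x_j/x_{n+1})^{a_{ij}}$, and then clearing denominators and removing common factors, so that it is written as $(x_1:\dots:x_{n+1})\mapsto(p_1:\dots:p_{n+1})$ with $p_1,\dots,p_{n+1}$ monomials of the same degree in $x_1,\dots,x_{n+1}$ with no joint common factor. This is the monomial map $f$ from $\mathbb{CP}^n$ to itself associated with $A$. It is a partial function, undefined at points where all $p_i$ vanish. Domain. Let $U\subseteq\mathbb{CP}^n$ be the set of points $x$ for which $f^N(x)$ (successive evaluation of $f$) is defined for all $N\ge1$. It is a dense open set, $f(U)\subseteq U$, and $f|_U$ is continuous. Topological entropy. Put on $\mathbb{CP}^n$ the metric $d$ in which the distance between two points is the angle $\theta\in[0,\pi/2]$ between the corresponding complex lines in $\mathbb C^{n+1}$. The topological entropy of $f$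 is the Bowen–Dinaburg entropy of $f|_U$ with respect to $d$, defined by separated (or spanning) sets: if $s(N,\varepsilon)$ is the maximal cardinality of a set $E\subseteq U$ such that any two distinct $x,y\in E$ satisfy $\max_{0\le k<N}d(f^k(x),f^k(y))>\varepsilon$, the entropy is $\lim_{\varepsilon\to0}\limsup_{N\to\infty}\frac1N\log s(N,\varepsilon)$. *)

theory Defs
  imports "HOL-Analysis.Analysis"
begin

section \<open>Complex projective space\<close>

text \<open>
  A point of the projective space of \<open>complex ^ 'm\<close> is a complex line through the origin, as a
  set of vectors. For \<open>\<complex>P\<^sup>n\<close> with \<open>n = CARD('n)\<close> the homogeneous coordinates are indexed by
  \<open>'n option\<close>, with \<open>None\<close> in the role of the last index \<open>n + 1\<close>.
\<close>

definition cline :: "complex ^ 'm \<Rightarrow> (complex ^ 'm) set" where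
  "cline v = range (\<lambda>c. c *s v)"

definition CP :: "(complex ^ 'm) set set" where
  "CP = {cline v | v. v \<noteq> 0}"

definition homcoords :: "(complex ^ 'm) set \<Rightarrow> complex ^ 'm" where
  "homcoords x = (SOME v. v \<noteq> 0 \<and> x = cline v)"

lemma homcoords:
  assumes "x \<in> CP"
  shows "homcoords x \<noteq> 0" "cline (homcoords x) = x"
proof -
  have "\<exists>v. v \<noteq> 0 \<and> x = cline v" using assms by (auto simp: CP_def)
  from someI_ex[OF this] show "homcoords x \<noteq> 0" "cline (homcoords x) = x"
    by (auto simp: homcoords_def)
qed

lemma cline_CP [simp]: "v \<noteq> 0 \<Longrightarrow> cline v \<in> CP"
  by (auto simp: CP_def)

lemma cline_scale:
  assumes "c \<noteq> 0"
  shows "cline (c *s v) = cline v"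
proof -
  have "a *s v = (a / c) *s (c *s v)" for a using assms by (simp add: vector_smult_assoc)
  moreover have "a *s (c *s v) = (a * c) *s v" for a by (simp add: vector_smult_assoc)
  ultimately show ?thesis unfolding cline_def by (metis (no_types, lifting) image_subset_iff rangeI subset_antisym)
qed

lemma homcoords_cline:
  assumes "v \<noteq> 0"
  obtains c where "c \<noteq> 0" "homcoords (cline v) = c *s v"
proof -
  let ?w = "homcoords (cline v)"
  have w: "?w \<noteq> 0" "cline ?w = cline v" using homcoords[OF cline_CP[OF assms]] by auto
  have "?w = 1 *s ?w" by simp
  hence "?w \<in> cline ?w" unfolding cline_def by (metis rangeI)
  then obtain c where c: "?w = c *s v" using w(2) by (auto simp: cline_def)
  have "c \<noteq> 0" using c w(1) by auto
  thus ?thesis using c that by blast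
qed

definition hermitian_inner :: "complex ^ 'm \<Rightarrow> complex ^ 'm \<Rightarrow> complex" where
  "hermitian_inner v w = (\<Sum>i\<in>UNIV. v $ i * cnj (w $ i))"

definition line_angle :: "(complex ^ 'm) set \<Rightarrow> (complex ^ 'm) set \<Rightarrow> real" where
  "line_angle x y = (let v = homcoords x; w = homcoords y in
     arccos (cmod (hermitian_inner v w) / (norm v * norm w)))"

lemma norm_smult_complex: "norm (c *s (v :: complex ^ 'm)) = cmod c * norm v"
  by (simp add: norm_vec_def norm_mult L2_set_right_distrib)

lemma hermitian_inner_smult:
  "hermitian_inner (a *s v) (b *s w) = a * cnj b * hermitian_inner v w"
  by (simp add: hermitian_inner_def sum_distrib_left mult_ac)

text \<open>The angle does not depend on the chosen homogeneous coordinates.\<close>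

lemma line_angle_cline:
  assumes "v \<noteq> 0" "w \<noteq> 0"
  shows "line_angle (cline v) (cline w) =
           arccos (cmod (hermitian_inner v w) / (norm v * norm w))"
proof -
  obtain a where a: "a \<noteq> 0" "homcoords (cline v) = a *s v" by (rule homcoords_cline[OF assms(1)])
  obtain b where b: "b \<noteq> 0" "homcoords (cline w) = b *s w" by (rule homcoords_cline[OF assms(2)])
  show ?thesis using a b
    by (simp add: line_angle_def Let_def hermitian_inner_smult norm_smult_complex norm_mult
        divide_simps)
qed


section \<open>Projective monomial maps\<close>

text \<open>
  Exponent of the homogeneous coordinate \<open>x\<^sub>j\<close> in the \<open>i\<close>-th component of
  \<open>(y\<^sub>1 : \<dots> : y\<^sub>n : 1)\<close>, where \<open>y\<^sub>i = \<Prod>\<^sub>j (x\<^sub>j / x\<^sub>n\<^sub>+\<^sub>1) ^ a\<^sub>i\<^sub>j\<close>; it may be negative.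
\<close>

fun laurent_exp :: "int ^ 'n ^ 'n \<Rightarrow> 'n option \<Rightarrow> 'n option \<Rightarrow> int" where
  "laurent_exp A (Some i) (Some j) = A $ i $ j"
| "laurent_exp A (Some i) None = - (\<Sum>k\<in>UNIV. A $ i $ k)"
| "laurent_exp A None j = 0"

text \<open>
  Exponent of \<open>x\<^sub>j\<close> in the monomial \<open>p\<^sub>i\<close>. Dividing all components by
  \<open>x\<^sub>j ^ (MIN k. laurent_exp A k j)\<close>, for each \<open>j\<close>, both clears the denominators and removes the
  common factors: afterwards all exponents of \<open>x\<^sub>j\<close> are nonnegative and one of them is \<open>0\<close>.
\<close>

definition monomial_exp :: "int ^ 'n ^ 'n \<Rightarrow> 'n option \<Rightarrow> 'n option \<Rightarrow> nat" where
  "monomial_exp A i j = nat (laurent_exp A i j - (MIN k. laurent_exp A k j))"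

definition monomials :: "int ^ 'n ^ 'n \<Rightarrow> complex ^ ('n option) \<Rightarrow> complex ^ ('n option)" where
  "monomials A v = (\<chi> i. \<Prod>j\<in>UNIV. (v $ j) ^ monomial_exp A i j)"

definition monomial_map ::
    "int ^ 'n ^ 'n \<Rightarrow> (complex ^ ('n option)) set \<Rightarrow> (complex ^ ('n option)) set option" where
  "monomial_map A x = (let w = monomials A (homcoords x) in if w = 0 then None else Some (cline w))"

lemma int_monomial_exp:
  "int (monomial_exp A i j) = laurent_exp A i j - (MIN k. laurent_exp A k j)"
  by (simp add: monomial_exp_def)

lemma UNIV_option_sum: "(\<Sum>j\<in>UNIV. g j) = g None + (\<Sum>j\<in>UNIV. g (Some j))"
  for g :: "'n::finite option \<Rightarrow> 'b::comm_monoid_add"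
  by (simp add: UNIV_option_conv sum.reindex)

lemma UNIV_option_prod: "(\<Prod>j\<in>UNIV. g j) = g None * (\<Prod>j\<in>UNIV. g (Some j))"
  for g :: "'n::finite option \<Rightarrow> 'b::comm_monoid_mult"
  by (simp add: UNIV_option_conv prod.reindex)

text \<open>The \<open>p\<^sub>i\<close> have the same degree and no common factor, and \<open>p\<^sub>i / p\<^sub>n\<^sub>+\<^sub>1 = y\<^sub>i\<close>.\<close>

lemma monomial_exp_same_degree:
  "(\<Sum>j\<in>UNIV. monomial_exp A i j) = (\<Sum>j\<in>UNIV. monomial_exp A i' j)"
proof -
  have "(\<Sum>j\<in>UNIV. laurent_exp A i j) = 0" for i by (cases i) (simp_all add: UNIV_option_sum)
  hence "int (\<Sum>j\<in>UNIV. monomial_exp A i j) = - (\<Sum>j\<in>UNIV. MIN k. laurent_exp A k j)" for i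
    by (simp add: int_monomial_exp sum_subtractf)
  thus ?thesis by (metis of_nat_eq_iff)
qed

lemma monomial_exp_no_common_factor: "\<exists>i. monomial_exp A i j = 0"
proof -
  have "(MIN k. laurent_exp A k j) \<in> range (\<lambda>k. laurent_exp A k j)" by (rule Min_in) auto
  then obtain i where "(MIN k. laurent_exp A k j) = laurent_exp A i j" by (elim imageE)
  thus ?thesis by (auto simp: monomial_exp_def)
qed

lemma monomials_affine:
  assumes nz: "\<And>j. v $ j \<noteq> 0"
  shows "monomials A v $ Some i / monomials A v $ None =
           (\<Prod>j\<in>UNIV. (v $ Some j / v $ None) powi (A $ i $ j))"
proof -
  have 1: "(v $ j) ^ monomial_exp A k j =
      (v $ j) powi laurent_exp A k j / (v $ j) powi (MIN k. laurent_exp A k j)" for k j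
  proof -
    have "(v $ j) ^ monomial_exp A k j = (v $ j) powi int (monomial_exp A k j)" by simp
    thus ?thesis unfolding int_monomial_exp using nz[of j] by (simp add: power_int_diff)
  qed
  let ?m = "\<Prod>j\<in>UNIV. (v $ j) powi (MIN k. laurent_exp A k j)"
  have m: "?m \<noteq> 0" using nz by simp
  have 2: "monomials A v $ k = (\<Prod>j\<in>UNIV. (v $ j) powi laurent_exp A k j) / ?m" for k
    by (simp add: monomials_def 1 prod_dividef)
  have 3: "x powi (\<Sum>k\<in>K. e k) = (\<Prod>k\<in>K. x powi e k)" if "finite K" "x \<noteq> 0"
    for x :: complex and K and e :: "'a \<Rightarrow> int"
    using that by (induction K rule: finite_induct) (simp_all add: power_int_add)
  have "monomials A v $ Some i / monomials A v $ None = (\<Prod>j\<in>UNIV. (v $ j) powi laurent_exp A (Some i) j)"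
    using m by (simp add: 2)
  also have "\<dots> = (\<Prod>j\<in>UNIV. (v $ Some j / v $ None) powi (A $ i $ j))"
    using nz by (simp add: UNIV_option_prod power_int_minus 3 power_int_divide_distrib prod_dividef
        divide_inverse mult.commute prod.distrib power_int_inverse power_int_mult_distrib
        flip: prod_inversef)
  finally show ?thesis .
qed

text \<open>The map does not depend on the chosen homogeneous coordinates.\<close>

lemma monomials_scale:
  "monomials A (c *s v) = c ^ (\<Sum>j\<in>UNIV. monomial_exp A None j) *s monomials A v"
proof -
  have "(\<Prod>j\<in>UNIV. ((c *s v) $ j) ^ monomial_exp A i j) =
      c ^ (\<Sum>j\<in>UNIV. monomial_exp A None j) * (\<Prod>j\<in>UNIV. (v $ j) ^ monomial_exp A i j)" for i
    unfolding monomial_exp_same_degree[of A None i]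
    by (simp add: power_mult_distrib prod.distrib power_sum)
  thus ?thesis by (simp add: monomials_def vec_eq_iff del: mult_cancel_left)
qed

lemma monomial_map_cline:
  assumes "v \<noteq> 0"
  shows "monomial_map A (cline v) =
           (if monomials A v = 0 then None else Some (cline (monomials A v)))"
proof -
  obtain c where c: "c \<noteq> 0" "homcoords (cline v) = c *s v" by (rule homcoords_cline[OF assms])
  define d where "d = c ^ (\<Sum>j\<in>UNIV. monomial_exp A None j)"
  have "d \<noteq> 0" "monomials A (homcoords (cline v)) = d *s monomials A v"
    using c by (simp_all add: d_def monomials_scale)
  thus ?thesis by (simp add: monomial_map_def Let_def cline_scale)
qed

definition monomial_iter ::
    "int ^ 'n ^ 'n \<Rightarrow> nat \<Rightarrow> (complex ^ ('n option)) set \<Rightarrow> (complex ^ ('n option)) set option" where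
  "monomial_iter A N x = ((\<lambda>y. Option.bind y (monomial_map A)) ^^ N) (Some x)"

definition monomial_domain :: "int ^ 'n ^ 'n \<Rightarrow> (complex ^ ('n option)) set set" where
  "monomial_domain A = {x \<in> CP. \<forall>N\<ge>1. monomial_iter A N x \<noteq> None}"

text \<open>The value at points where the monomial map is undefined is irrelevant.\<close>

definition monomial_fun ::
    "int ^ 'n ^ 'n \<Rightarrow> (complex ^ ('n option)) set \<Rightarrow> (complex ^ ('n option)) set" where
  "monomial_fun A x = the (monomial_map A x)"

lemma monomial_fun_domain:
  assumes "x \<in> monomial_domain A"
  shows "monomial_map A x = Some (monomial_fun A x)" "monomial_fun A x \<in> monomial_domain A"
proof -
  have "monomial_iter A 1 x \<noteq> None" using assms unfolding monomial_domain_def by blast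
  thus eq: "monomial_map A x = Some (monomial_fun A x)"
    by (auto simp: monomial_iter_def monomial_fun_def)
  have CP: "monomial_fun A x \<in> CP"
    using eq cline_CP unfolding monomial_map_def Let_def by (metis option.distinct(1) option.inject)
  have "monomial_iter A N (monomial_fun A x) = monomial_iter A (Suc N) x" for N
    using eq by (simp add: monomial_iter_def funpow_Suc_right del: funpow.simps(2))
  moreover have "monomial_iter A (Suc N) x \<noteq> None" for N
    using assms unfolding monomial_domain_def by auto
  ultimately show "monomial_fun A x \<in> monomial_domain A" using CP by (simp add: monomial_domain_def)
qed


section \<open>Bowen--Dinaburg entropy\<close>

text \<open>Only used for \<open>N \<ge> 1\<close>; the value for \<open>N = 0\<close> does not affect the entropy.\<close>

definition bowen_dist :: "('a \<Rightarrow> 'a \<Rightarrow> real) \<Rightarrow> ('a \<Rightarrow> 'a) \<Rightarrow> nat \<Rightarrow> 'a \<Rightarrow> 'a \<Rightarrow> real" where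
  "bowen_dist d f N x y = (MAX k\<in>{..<N}. d ((f ^^ k) x) ((f ^^ k) y))"

definition separated ::
    "('a \<Rightarrow> 'a \<Rightarrow> real) \<Rightarrow> ('a \<Rightarrow> 'a) \<Rightarrow> 'a set \<Rightarrow> nat \<Rightarrow> real \<Rightarrow> 'a set \<Rightarrow> bool" where
  "separated d f U N \<epsilon> E \<longleftrightarrow>
     E \<subseteq> U \<and> (\<forall>x\<in>E. \<forall>y\<in>E. x \<noteq> y \<longrightarrow> bowen_dist d f N x y > \<epsilon>)"

text \<open>
  The supremum is \<open>\<infinity>\<close> iff there are arbitrarily large finite separated sets; subsets of separated
  sets are separated, so infinite separated sets need not be considered.
\<close>

definition sep_number ::
    "('a \<Rightarrow> 'a \<Rightarrow> real) \<Rightarrow> ('a \<Rightarrow> 'a) \<Rightarrow> 'a set \<Rightarrow> nat \<Rightarrow> real \<Rightarrow> enat" where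
  "sep_number d f U N \<epsilon> = (SUP E\<in>{E. finite E \<and> separated d f U N \<epsilon> E}. enat (card E))"

fun ln_enat :: "enat \<Rightarrow> ereal" where
  "ln_enat (enat m) = (if m = 0 then -\<infinity> else ereal (ln (real m)))"
| "ln_enat \<infinity> = \<infinity>"

definition sep_growth ::
    "('a \<Rightarrow> 'a \<Rightarrow> real) \<Rightarrow> ('a \<Rightarrow> 'a) \<Rightarrow> 'a set \<Rightarrow> real \<Rightarrow> ereal" where
  "sep_growth d f U \<epsilon> = limsup (\<lambda>N. ln_enat (sep_number d f U N \<epsilon>) / ereal (real N))"

definition bowen_entropy :: "('a \<Rightarrow> 'a \<Rightarrow> real) \<Rightarrow> ('a \<Rightarrow> 'a) \<Rightarrow> 'a set \<Rightarrow> ereal" where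
  "bowen_entropy d f U = Lim (at_right 0) (sep_growth d f U)"

lemma ln_enat_mono:
  assumes "a \<le> b"
  shows "ln_enat a \<le> ln_enat b"
  using assms by (cases a; cases b) auto

lemma sep_growth_antimono:
  assumes "\<delta> \<le> \<epsilon>"
  shows "sep_growth d f U \<epsilon> \<le> sep_growth d f U \<delta>"
proof -
  have "separated d f U N \<epsilon> E \<Longrightarrow> separated d f U N \<delta> E" for N E
    using assms by (force simp: separated_def)
  hence "sep_number d f U N \<epsilon> \<le> sep_number d f U N \<delta>" for N
    unfolding sep_number_def by (intro SUP_subset_mono) auto
  thus ?thesis
    unfolding sep_growth_def
    by (intro Limsup_mono eventually_mono[OF eventually_gt_at_top[of 0]])
       (auto intro!: ereal_divide_right_mono ln_enat_mono)
qed

text \<open>The limit for \<open>\<epsilon> \<rightarrow> 0\<close> exists in the extended reals.\<close>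

lemma bowen_entropy_tendsto: "(sep_growth d f U \<longlongrightarrow> (SUP \<epsilon>\<in>{0<..}. sep_growth d f U \<epsilon>)) (at_right 0)"
proof (rule increasing_tendsto)
  show "\<forall>\<^sub>F \<epsilon> in at_right 0. sep_growth d f U \<epsilon> \<le> (SUP \<epsilon>\<in>{0<..}. sep_growth d f U \<epsilon>)"
    by (auto simp: eventually_at_filter intro!: always_eventually SUP_upper)
next
  fix x assume "x < (SUP \<epsilon>\<in>{0<..}. sep_growth d f U \<epsilon>)"
  then obtain \<epsilon> :: real where e: "\<epsilon> > 0" "x < sep_growth d f U \<epsilon>" by (auto simp: less_SUP_iff)
  have "\<forall>\<^sub>F \<delta> in at_right 0. \<delta> < \<epsilon>" using e(1) by (auto simp: eventually_at_right)
  thus "\<forall>\<^sub>F \<delta> in at_right 0. x < sep_growth d f U \<delta>"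
    by (rule eventually_mono) (use e(2) sep_growth_antimono less_le_trans less_imp_le in metis)
qed

lemma bowen_entropy_eq_SUP: "bowen_entropy d f U = (SUP \<epsilon>\<in>{0<..}. sep_growth d f U \<epsilon>)"
  unfolding bowen_entropy_def by (rule tendsto_Lim[OF _ bowen_entropy_tendsto]) simp

definition monomial_entropy :: "int ^ 'n ^ 'n \<Rightarrow> ereal" where
  "monomial_entropy A = bowen_entropy line_angle (monomial_fun A) (monomial_domain A)"


section \<open>Eigenvalues\<close>

definition eigenvalue :: "complex ^ 'n ^ 'n \<Rightarrow> complex \<Rightarrow> bool" where
  "eigenvalue M \<mu> \<longleftrightarrow> (\<exists>v. v \<noteq> 0 \<and> M *v v = \<mu> *s v)"

definition char_poly :: "complex ^ 'n ^ 'n \<Rightarrow> complex poly" where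
  "char_poly M = det (mat [:0, 1:] - map_matrix (\<lambda>a. [:a:]) M)"

definition alg_multiplicity :: "complex ^ 'n ^ 'n \<Rightarrow> complex \<Rightarrow> nat" where
  "alg_multiplicity M \<mu> = order \<mu> (char_poly M)"

lemma poly_char_poly: "poly (char_poly M) \<mu> = det (mat \<mu> - M)"
  by (simp add: char_poly_def det_def poly_sum poly_prod mat_def of_int_poly if_distrib[of "\<lambda>p. poly p \<mu>"]
      cong: if_cong)

lemma eigenvalue_iff_root: "eigenvalue M \<mu> \<longleftrightarrow> poly (char_poly M) \<mu> = 0"
proof -
  have mv: "(mat \<mu> - M) *v v = \<mu> *s v - M *v v" for v
    by (simp add: vec_eq_iff matrix_vector_mult_def mat_def left_diff_distrib sum_subtractf
        if_distrib[of "\<lambda>a. a * _"] cong: if_cong)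
  have "poly (char_poly M) \<mu> = 0 \<longleftrightarrow> \<not> invertible (mat \<mu> - M)"
    by (simp add: poly_char_poly invertible_det_nz)
  also have "\<dots> \<longleftrightarrow> (\<exists>v. v \<noteq> 0 \<and> (mat \<mu> - M) *v v = 0)"
    unfolding invertible_left_inverse matrix_left_invertible_ker by blast
  also have "\<dots> \<longleftrightarrow> eigenvalue M \<mu>"
    by (auto simp: mv eigenvalue_def)
  finally show ?thesis by simp
qed

end

theory Submission
  imports Defs "HOL-Computational_Algebra.Fundamental_Theorem_Algebra"
begin

text \<open>
  The compact torus \<open>{|u\<^sub>1| = \<dots> = |u\<^sub>n| = 1}\<close>, embedded as \<open>(u\<^sub>1 : \<dots> : u\<^sub>n : 1)\<close>, lies in
  the domain, and there the monomial map is the linear torus endomorphism \<open>x \<mapsto> A x\<close> of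
  \<open>\<real>\<^sup>n / \<int>\<^sup>n\<close>. It suffices to find many separated points on this torus, and they can be written
  down without splitting \<open>\<real>\<^sup>n\<close> into stable and unstable directions.

  Put \<open>M = 2 - A\<^sup>N\<close> and take points of \<open>[0,1)\<^sup>n\<close> whose differences are mapped by \<open>M\<close> into \<open>\<int>\<^sup>n\<close>.
  If two of them stay \<open>\<delta>\<close>-close modulo \<open>\<int>\<^sup>n\<close> up to time \<open>N\<close>, then, for \<open>\<delta>\<close> small compared with
  the entries of \<open>A\<close>, the integer vectors involved must be compatible along the orbit: after
  subtracting one integer vector, the difference \<open>v\<close> satisfies \<open>|A\<^sup>k v| \<le> \<delta>\<close> for all \<open>k \<le> N\<close>.
  Hence \<open>|M v| \<le> 3 \<delta> < 1\<close> while \<open>M v\<close> is an integer vector, so \<open>M v = 0\<close> and \<open>v = 0\<close>: the points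
  coincide (\<open>orbit_near_int_imp_int\<close>). By a volume count there are at least \<open>|det M|\<close> such points
  (\<open>lattice_points_in_unit_cube\<close>).

  Finally \<open>|det (2 - A\<^sup>N)|\<close> is the product of \<open>|2 - \<lambda>\<^sup>N|\<close> over the eigenvalues \<open>\<lambda>\<close>. An eigenvalue
  in the closed unit disc contributes a factor at least \<open>1\<close>, which is why \<open>2\<close> is used rather than
  \<open>1\<close>; an eigenvalue outside it contributes at least \<open>|\<lambda>|\<^sup>N / 2\<close> for large \<open>N\<close>. So the
  determinant grows at least like the \<open>N\<close>-th power of the product of the expanding eigenvalues
  (\<open>det_two_minus_power_growth\<close>). The limit superior only needs this along a subsequence, and
  \<open>N = 2\<^sup>m\<close> is convenient because \<open>c - X\<^sup>2\<close> splits into two factors of the same shape.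
\<close>

section \<open>Growth of \<open>det (2 - A\<^sup>N)\<close>\<close>

primrec mat_pow :: "'a::semiring_1 ^ 'n ^ 'n \<Rightarrow> nat \<Rightarrow> 'a ^ 'n ^ 'n" where
  "mat_pow A 0 = mat 1"
| "mat_pow A (Suc k) = A ** mat_pow A k"

lemma mat_pow_add: "mat_pow A (j + k) = mat_pow A j ** mat_pow A k"
  by (induction j) (simp_all add: matrix_mul_assoc)

lemma map_matrix_of_int_mult:
  "map_matrix of_int (A ** B) = (map_matrix of_int A ** map_matrix of_int B :: 'a::ring_1 ^ 'n ^ 'm)"
  for A :: "int ^ 'k ^ 'm" and B :: "int ^ 'n ^ 'k"
  by (simp add: vec_eq_iff matrix_matrix_mult_def)

lemma map_matrix_of_int_mat: "map_matrix of_int (mat c) = (mat (of_int c) :: 'a::ring_1 ^ 'n ^ 'n)"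
  by (simp add: vec_eq_iff mat_def)

lemma map_matrix_of_int_mat_pow:
  "map_matrix of_int (mat_pow A k) = (mat_pow (map_matrix of_int A) k :: 'a::ring_1 ^ 'n ^ 'n)"
  by (induction k) (simp_all add: map_matrix_of_int_mat map_matrix_of_int_mult)

lemma map_matrix_of_int_diff:
  "map_matrix of_int (A - B) = (map_matrix of_int A - map_matrix of_int B :: 'a::ring_1 ^ 'n ^ 'n)"
  by (simp add: vec_eq_iff)

lemma det_map_matrix_of_int:
  "det (map_matrix of_int A :: 'a::comm_ring_1 ^ 'n ^ 'n) = of_int (det A)"
  by (simp add: det_def)

text \<open>
  The only way to reach the degree \<open>card I\<close> in the product is to pick the linear term of every factor.
\<close>

lemma degree_coeff_prod_linear:
  fixes p :: "'i \<Rightarrow> 'a::comm_semiring_1 poly"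
  assumes "finite I" "\<And>i. i \<in> I \<Longrightarrow> degree (p i) \<le> 1"
  shows "degree (\<Prod>i\<in>I. p i) \<le> card I \<and> coeff (\<Prod>i\<in>I. p i) (card I) = (\<Prod>i\<in>I. coeff (p i) 1)"
  using assms
proof (induction I rule: finite_induct)
  case empty
  then show ?case by simp
next
  case (insert j I)
  let ?q = "\<Prod>i\<in>I. p i"
  have IH: "degree ?q \<le> card I" "coeff ?q (card I) = (\<Prod>i\<in>I. coeff (p i) 1)" and dj: "degree (p j) \<le> 1"
    using insert by auto
  have "degree (p j * ?q) \<le> 1 + card I"
    using degree_mult_le[of "p j" ?q] IH(1) dj by linarith
  moreover have "coeff (p j * ?q) (1 + card I) = coeff (p j) 1 * coeff ?q (card I)"
  proof -
    have "coeff (p j) i * coeff ?q (1 + card I - i) = 0" if "i \<noteq> 1" "i \<le> 1 + card I" for i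
    proof (cases "i = 0")
      case True
      then show ?thesis using IH(1) by (simp add: coeff_eq_0)
    next
      case False
      then show ?thesis using that dj by (simp add: coeff_eq_0)
    qed
    hence "(\<Sum>i\<le>1 + card I. coeff (p j) i * coeff ?q (1 + card I - i)) =
        (\<Sum>i\<in>{1}. coeff (p j) i * coeff ?q (1 + card I - i))"
      by (intro sum.mono_neutral_right) auto
    thus ?thesis by (simp add: coeff_mult)
  qed
  ultimately show ?case using insert IH(2) by simp
qed

text \<open>
  All entries of \<open>X - M\<close> have degree at most \<open>1\<close>, and the matrix of their linear coefficients is the
  identity. So the top coefficient of the determinant is the determinant of the identity.
\<close>

lemma monic_char_poly: "lead_coeff (char_poly M) = 1"
  for M :: "complex ^ 'n ^ 'n"
proof -
  let ?T = "mat [:0, 1:] - map_matrix (\<lambda>a. [:a:]) M :: complex poly ^ 'n ^ 'n"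
  have deg: "degree (?T $ i $ j) \<le> 1" and co: "coeff (?T $ i $ j) 1 = mat 1 $ i $ j" for i j
    by (auto simp: mat_def intro: order_trans[OF degree_diff_le])
  have lin: "degree (\<Prod>i\<in>UNIV. ?T $ i $ p i) \<le> CARD('n)"
    "coeff (\<Prod>i\<in>UNIV. ?T $ i $ p i) CARD('n) = (\<Prod>i\<in>UNIV. mat 1 $ i $ p i)" for p
    using degree_coeff_prod_linear[of UNIV "\<lambda>i. ?T $ i $ p i"] deg co by auto
  have "degree (char_poly M) \<le> CARD('n)"
    unfolding char_poly_def det_def
  proof (intro degree_sum_le, simp add: finite_permutations, goal_cases)
    case (1 p)
    have "degree (of_int (sign p) * (\<Prod>i\<in>UNIV. ?T $ i $ p i)) \<le> CARD('n)"
      using lin(1)[of p] by (simp add: sign_def)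
    thus ?case by simp
  qed
  moreover have "coeff (char_poly M) CARD('n) = 1"
  proof -
    have "coeff (char_poly M) CARD('n) = det (mat 1 :: complex ^ 'n ^ 'n)"
      unfolding char_poly_def det_def coeff_sum
    proof (intro sum.cong refl, goal_cases)
      case (1 p)
      show ?case using lin(2)[of p] by (simp add: sign_def)
    qed
    thus ?thesis by simp
  qed
  ultimately show ?thesis
    by (metis le_antisym le_degree zero_neq_one)
qed

lemma det_minus_eigenvalues:
  "det (mat c - M) = (\<Prod>\<mu> | eigenvalue M \<mu>. (c - \<mu>) ^ alg_multiplicity M \<mu>)"
  for M :: "complex ^ 'n ^ 'n"
proof -
  have "char_poly M = (\<Prod>\<mu> | eigenvalue M \<mu>. [:-\<mu>, 1:] ^ alg_multiplicity M \<mu>)"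
    using complex_poly_decompose[of "char_poly M"]
    by (simp add: monic_char_poly eigenvalue_iff_root alg_multiplicity_def)
  hence "poly (char_poly M) c = (\<Prod>\<mu> | eigenvalue M \<mu>. (c - \<mu>) ^ alg_multiplicity M \<mu>)"
    by (simp add: poly_prod)
  thus ?thesis by (simp add: poly_char_poly)
qed

lemma finite_eigenvalues: "finite {\<mu>. eigenvalue M \<mu>}"
  for M :: "complex ^ 'n ^ 'n"
proof -
  have "char_poly M \<noteq> 0" using monic_char_poly[of M] by auto
  thus ?thesis unfolding eigenvalue_iff_root by (rule poly_roots_finite)
qed

lemma cmod_det_uminus: "cmod (det (- M)) = cmod (det M)"
  for M :: "complex ^ 'n ^ 'n"
proof -
  have "- M = mat (-1) ** M"
    by (simp add: vec_eq_iff matrix_matrix_mult_def mat_def if_distrib[of "\<lambda>a. a * _"] cong: if_cong)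
  moreover have "cmod (det (mat (-1) :: complex ^ 'n ^ 'n)) = 1"
    by (subst det_diagonal) (simp_all add: mat_def norm_power)
  ultimately show ?thesis by (simp add: det_mul norm_mult)
qed

lemma mat_mult: "mat a ** M = M ** mat a" "(mat a ** mat b :: 'a ^ 'n ^ 'n) = mat (a * b)"
  for M :: "'a::comm_semiring_1 ^ 'n ^ 'n"
  by (simp_all add: vec_eq_iff matrix_matrix_mult_def mat_def if_distrib[of "\<lambda>a. a * _"]
      if_distrib[of "\<lambda>a. _ * a"] mult.commute cong: if_cong)

text \<open>
  From \<open>c = s\<^sup>2\<close> one gets \<open>c - M\<^sup>2\<^sup>K = (s - M\<^sup>K) (s + M\<^sup>K)\<close>. Up to sign both factors have the form
  \<open>c' - M\<^sup>K\<close>, so induction on the exponent of \<open>2\<close>, with \<open>c\<close> arbitrary, reduces the claim to the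
  characteristic polynomial. Moduli are used to avoid tracking the sign \<open>(-1)\<^sup>n\<close>.
\<close>

lemma cmod_det_minus_power:
  fixes M :: "complex ^ 'n ^ 'n"
  shows "cmod (det (mat c - mat_pow M (2 ^ m))) =
           (\<Prod>\<mu> | eigenvalue M \<mu>. cmod (c - \<mu> ^ (2 ^ m)) ^ alg_multiplicity M \<mu>)"
proof (induction m arbitrary: c)
  case 0
  then show ?case by (simp add: det_minus_eigenvalues norm_power flip: prod_norm)
next
  case (Suc m)
  define s where "s = csqrt c"
  define B where "B = mat_pow M (2 ^ m)"
  have s: "c = s * s" by (simp add: s_def flip: power2_eq_square)
  have pow: "mat_pow M (2 ^ Suc m) = B ** B"
    by (simp add: B_def mult_2 flip: mat_pow_add)
  have "(mat s - B) ** (mat s + B) = (mat s ** mat s + mat s ** B) - (B ** mat s + B ** B)"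
    by (simp add: vec_eq_iff matrix_matrix_mult_def sum_subtractf sum.distrib algebra_simps)
  also have "\<dots> = mat c - B ** B"
    unfolding s mat_mult(1)[of s B] mat_mult(2)[of s s] by (simp add: algebra_simps)
  also have "mat s + B = - (mat (- s) - B)"
    by (simp add: vec_eq_iff mat_def)
  finally have "mat c - mat_pow M (2 ^ Suc m) = (mat s - B) ** (- (mat (- s) - B))"
    unfolding pow by (rule sym)
  hence "cmod (det (mat c - mat_pow M (2 ^ Suc m))) =
      cmod (det (mat s - B)) * cmod (det (mat (- s) - B))"
    by (simp add: det_mul norm_mult cmod_det_uminus del: minus_diff_eq)
  also have "\<dots> = (\<Prod>\<mu> | eigenvalue M \<mu>.
      (cmod (s - \<mu> ^ 2 ^ m) * cmod (- s - \<mu> ^ 2 ^ m)) ^ alg_multiplicity M \<mu>)"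
    unfolding B_def Suc by (simp add: power_mult_distrib flip: prod.distrib)
  also have "\<dots> = (\<Prod>\<mu> | eigenvalue M \<mu>. cmod (c - \<mu> ^ 2 ^ Suc m) ^ alg_multiplicity M \<mu>)"
  proof (intro prod.cong refl arg_cong2[where f = power])
    fix \<mu>
    have "(s - \<mu> ^ 2 ^ m) * (- s - \<mu> ^ 2 ^ m) = - (c - \<mu> ^ 2 ^ Suc m)"
      by (simp add: s power_mult algebra_simps power2_eq_square)
    thus "cmod (s - \<mu> ^ 2 ^ m) * cmod (- s - \<mu> ^ 2 ^ m) = cmod (c - \<mu> ^ 2 ^ Suc m)"
      by (metis norm_minus_cancel norm_mult)
  qed
  finally show ?case .
qed

text \<open>
  Each eigenvalue outside the unit circle loses at most a factor \<open>2\<close> when \<open>|\<mu>\<^sup>N|\<close> is replaced by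
  \<open>|2 - \<mu>\<^sup>N|\<close>, as soon as \<open>|\<mu>|\<^sup>N \<ge> 4\<close>; every other eigenvalue has \<open>|2 - \<mu>\<^sup>N| \<ge> 1\<close>.
\<close>

lemma det_two_minus_power_growth:
  fixes M :: "complex ^ 'n ^ 'n"
  defines "P \<equiv> cmod (\<Prod>\<mu> | eigenvalue M \<mu> \<and> cmod \<mu> > 1. \<mu> ^ alg_multiplicity M \<mu>)"
  obtains C where "C > 0"
    "\<forall>\<^sub>F m in sequentially. C * P ^ (2 ^ m) \<le> cmod (det (mat 2 - mat_pow M (2 ^ m)))"
proof -
  let ?a = "alg_multiplicity M"
  define S where "S = {\<mu>. eigenvalue M \<mu> \<and> cmod \<mu> > 1}"
  define R where "R = {\<mu>. eigenvalue M \<mu> \<and> cmod \<mu> \<le> 1}"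
  have fin: "finite S" "finite R" and dec: "{\<mu>. eigenvalue M \<mu>} = S \<union> R" "S \<inter> R = {}"
    using finite_eigenvalues[of M] by (auto simp: S_def R_def)
  have P: "P = (\<Prod>\<mu>\<in>S. cmod \<mu> ^ ?a \<mu>)"
    by (simp add: P_def S_def norm_power flip: prod_norm)
  have "\<forall>\<^sub>F m in sequentially. \<forall>\<mu>\<in>S. 4 \<le> cmod \<mu> ^ (2 ^ m)"
  proof (intro eventually_ball_finite ballI fin(1))
    fix \<mu> assume "\<mu> \<in> S"
    hence "cmod \<mu> > 1" by (simp add: S_def)
    hence "filterlim (\<lambda>m. \<mu> ^ m) at_infinity sequentially"
      by (rule filterlim_realpow_sequentially_gt1)
    hence ev: "\<forall>\<^sub>F m in sequentially. 4 \<le> cmod \<mu> ^ m"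
      by (simp add: filterlim_at_infinity[of 0] norm_power)
    have "filterlim (\<lambda>m::nat. 2 ^ m :: nat) sequentially sequentially"
      by (rule filterlim_subseq) (simp add: strict_mono_def)
    from eventually_compose_filterlim[OF ev this]
    show "\<forall>\<^sub>F m in sequentially. 4 \<le> cmod \<mu> ^ (2 ^ m)" .
  qed
  hence "\<forall>\<^sub>F m in sequentially.
      (\<Prod>\<mu>\<in>S. (1 / 2) ^ ?a \<mu>) * P ^ (2 ^ m) \<le> cmod (det (mat 2 - mat_pow M (2 ^ m)))"
  proof (rule eventually_mono)
    fix m assume big: "\<forall>\<mu>\<in>S. 4 \<le> cmod \<mu> ^ (2 ^ m)"
    have tri: "cmod (2 - \<mu> ^ 2 ^ m) \<ge> \<bar>cmod \<mu> ^ 2 ^ m - 2\<bar>" for \<mu>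
      using norm_triangle_ineq3[of 2 "\<mu> ^ 2 ^ m"] by (simp add: norm_power abs_minus_commute)
    have "(\<Prod>\<mu>\<in>S. (1 / 2) ^ ?a \<mu>) * P ^ (2 ^ m) = (\<Prod>\<mu>\<in>S. (1 / 2 * cmod \<mu> ^ 2 ^ m) ^ ?a \<mu>)"
      by (simp add: P prod_power_distrib prod.distrib[symmetric] power_divide power_mult_distrib
          mult.commute flip: power_mult)
    also have "\<dots> \<le> (\<Prod>\<mu>\<in>S. cmod (2 - \<mu> ^ 2 ^ m) ^ ?a \<mu>)"
    proof (intro prod_mono conjI power_mono)
      fix \<mu> assume "\<mu> \<in> S"
      thus "1 / 2 * cmod \<mu> ^ 2 ^ m \<le> cmod (2 - \<mu> ^ 2 ^ m)"
        using big tri[of \<mu>] by fastforce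
    qed auto
    also have "\<dots> \<le> (\<Prod>\<mu>\<in>S. cmod (2 - \<mu> ^ 2 ^ m) ^ ?a \<mu>) * (\<Prod>\<mu>\<in>R. cmod (2 - \<mu> ^ 2 ^ m) ^ ?a \<mu>)"
    proof -
      have "1 \<le> (\<Prod>\<mu>\<in>R. cmod (2 - \<mu> ^ 2 ^ m) ^ ?a \<mu>)"
      proof (intro prod_ge_1 one_le_power)
        fix \<mu> assume "\<mu> \<in> R"
        hence "cmod \<mu> ^ 2 ^ m \<le> 1" by (simp add: R_def power_le_one)
        thus "1 \<le> cmod (2 - \<mu> ^ 2 ^ m)" using tri[of \<mu>] by linarith
      qed
      moreover have "0 \<le> (\<Prod>\<mu>\<in>S. cmod (2 - \<mu> ^ 2 ^ m) ^ ?a \<mu>)" by (simp add: prod_nonneg)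
      ultimately show ?thesis by (simp add: mult_le_cancel_left1)
    qed
    also have "\<dots> = cmod (det (mat 2 - mat_pow M (2 ^ m)))"
      by (simp add: cmod_det_minus_power dec fin prod.union_disjoint)
    finally show "(\<Prod>\<mu>\<in>S. (1 / 2) ^ ?a \<mu>) * P ^ (2 ^ m) \<le> cmod (det (mat 2 - mat_pow M (2 ^ m)))" .
  qed
  moreover have "(\<Prod>\<mu>\<in>S. (1 / 2) ^ ?a \<mu>) > (0::real)" by (simp add: prod_pos)
  ultimately show ?thesis using that by blast
qed

section \<open>Counting lattice points by volume\<close>

lemma finite_int_box: "finite {p :: int ^ 'n. \<forall>i. \<bar>p $ i\<bar> \<le> K}"
proof -
  have "{p :: int ^ 'n. \<forall>i. \<bar>p $ i\<bar> \<le> K} \<subseteq> vec_lambda ` (UNIV \<rightarrow>\<^sub>E {-K..K})"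
  proof
    fix p :: "int ^ 'n" assume "p \<in> {p. \<forall>i. \<bar>p $ i\<bar> \<le> K}"
    hence "vec_nth p \<in> UNIV \<rightarrow>\<^sub>E {-K..K}" by (auto simp: abs_le_iff minus_le_iff)
    thus "p \<in> vec_lambda ` (UNIV \<rightarrow>\<^sub>E {-K..K})" by (metis image_eqI vec_nth_inverse)
  qed
  thus ?thesis by (rule finite_subset) (intro finite_imageI finite_PiE; simp)
qed

definition unit_cube :: "(real ^ 'n) set" where
  "unit_cube = {x. \<forall>i. 0 \<le> x $ i \<and> x $ i < 1}"

definition int_vec :: "int ^ 'n \<Rightarrow> real ^ 'n" where
  "int_vec p = (\<chi> i. of_int (p $ i))"

lemma int_vec_nth [simp]: "int_vec p $ i = of_int (p $ i)"
  by (simp add: int_vec_def)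

lemma int_vec_eq_iff: "int_vec p = int_vec q \<longleftrightarrow> p = q"
  by (simp add: vec_eq_iff)

lemma unit_cube_lmeasurable: "(unit_cube :: (real ^ 'n) set) \<in> lmeasurable"
  and measure_unit_cube: "measure lebesgue (unit_cube :: (real ^ 'n) set) = 1"
proof -
  let ?Q = "unit_cube :: (real ^ 'n) set"
  have sub: "box 0 1 \<subseteq> ?Q" "?Q \<subseteq> cbox 0 1"
    by (auto simp: unit_cube_def mem_box_cart less_imp_le)
  have neg: "negligible (cbox 0 1 - box 0 (1 :: real ^ 'n))" by (rule negligible_frontier_interval)
  have m1: "measure lebesgue (cbox 0 (1 :: real ^ 'n)) = 1"
    by (simp add: measure_completion content_cbox_cart interval_eq_empty_cart)
  have n2: "negligible (sym_diff (cbox 0 1) ?Q)"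
    by (rule negligible_subset[OF neg]) (use sub in auto)
  show "?Q \<in> lmeasurable"
    by (rule lmeasurable_negligible_symdiff[OF lmeasurable_cbox n2])
  show "measure lebesgue ?Q = 1"
    using measure_negligible_symdiff[OF _ n2] m1 by simp
qed

text \<open>
  This is Blichfeldt's averaging argument. The image \<open>S\<close> of the unit cube has volume \<open>|det M|\<close>. Cut it
  along the integer grid and move all pieces into the unit cube: on average a point \<open>t\<close> is covered
  \<open>|det M|\<close> times, hence some \<open>t\<close> is covered at least that often. The preimages of the points
  \<open>t + p\<close> of \<open>S\<close> then differ by vectors that \<open>M\<close> sends to integer vectors.
\<close>

lemma lattice_points_in_unit_cube_ordered:
  fixes M :: "real ^ 'w::{finite,wellorder} ^ 'w::_"
  obtains E where "finite E" "E \<subseteq> unit_cube" "\<bar>det M\<bar> \<le> card E"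
    "\<And>x y. x \<in> E \<Longrightarrow> y \<in> E \<Longrightarrow> \<exists>p. M *v (x - y) = int_vec p"
proof -
  let ?Q = "unit_cube :: (real ^ 'w::_) set"
  define S where "S = (*v) M ` ?Q"
  have S: "S \<in> lmeasurable" and mS: "measure lebesgue S = \<bar>det M\<bar>"
    unfolding S_def
    using measurable_linear_image[OF matrix_vector_mul_linear unit_cube_lmeasurable, of M]
      measure_linear_image[OF matrix_vector_mul_linear unit_cube_lmeasurable, of M]
    by (simp_all add: measure_unit_cube)
  have "bounded ?Q"
    by (rule bounded_subset[OF bounded_cbox[of 0 1]])
       (auto simp: unit_cube_def mem_box_cart less_imp_le)
  hence "bounded S" unfolding S_def by (rule bounded_linear_image) simp
  then obtain b where b: "\<And>y. y \<in> S \<Longrightarrow> norm y \<le> b" unfolding bounded_iff by blast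
  \<comment> \<open>The finitely many grid cells that can meet \<open>S\<close>.\<close>
  define F where "F = {p :: int ^ 'w::_. \<forall>i. \<bar>p $ i\<bar> \<le> \<lceil>b\<rceil> + 1}"
  have finF: "finite F" unfolding F_def by (rule finite_int_box)
  \<comment> \<open>\<open>cell p\<close> is the piece of \<open>S\<close> in the grid cell at \<open>p\<close>, and \<open>T p\<close> is that piece moved to the unit cube.\<close>
  define T where "T p = ((\<lambda>y. y - int_vec p) ` S) \<inter> ?Q" for p :: "int ^ 'w::_"
  have T: "T p \<in> lmeasurable" for p
    unfolding T_def by (intro fmeasurable.Int measurable_translation_subtract S unit_cube_lmeasurable)
  define cell where "cell p = S \<inter> (\<lambda>t. int_vec p + t) ` ?Q" for p :: "int ^ 'w::_"
  have cellT: "cell p = (\<lambda>t. int_vec p + t) ` T p" for p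
  proof (intro subset_antisym subsetI)
    fix y assume "y \<in> cell p"
    then obtain t where "t \<in> ?Q" "y = int_vec p + t" "y \<in> S" by (auto simp: cell_def)
    moreover from this have "t \<in> (\<lambda>y. y - int_vec p) ` S" by (intro image_eqI[of _ _ y]) auto
    ultimately show "y \<in> (\<lambda>t. int_vec p + t) ` T p" by (auto simp: T_def)
  qed (auto simp: cell_def T_def)
  have cell: "cell p \<in> lmeasurable" "measure lebesgue (cell p) = measure lebesgue (T p)" for p
    unfolding cellT using measurable_translation[OF T] measure_translation by auto
  have floor_cell: "y \<in> (\<lambda>t. int_vec p + t) ` ?Q \<longleftrightarrow> p = (\<chi> i. \<lfloor>y $ i\<rfloor>)" for y p
  proof
    assume "y \<in> (\<lambda>t. int_vec p + t) ` ?Q"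
    thus "p = (\<chi> i. \<lfloor>y $ i\<rfloor>)" by (auto simp: unit_cube_def vec_eq_iff floor_unique)
  next
    assume p: "p = (\<chi> i. \<lfloor>y $ i\<rfloor>)"
    have "y - int_vec p \<in> ?Q" by (auto simp: p unit_cube_def) linarith
    thus "y \<in> (\<lambda>t. int_vec p + t) ` ?Q" by (intro image_eqI[of _ _ "y - int_vec p"]) auto
  qed
  have "S = (\<Union>p\<in>F. cell p)"
  proof (intro subset_antisym subsetI)
    fix y assume y: "y \<in> S"
    have "\<bar>\<lfloor>y $ i\<rfloor>\<bar> \<le> \<lceil>b\<rceil> + 1" for i
      using component_le_norm_cart[of y i] b[OF y] by linarith
    hence "(\<chi> i. \<lfloor>y $ i\<rfloor>) \<in> F" by (simp add: F_def)
    thus "y \<in> (\<Union>p\<in>F. cell p)" using y floor_cell unfolding cell_def by blast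
  qed (auto simp: cell_def)
  moreover have "disjoint_family_on cell F"
    unfolding disjoint_family_on_def
  proof (intro ballI impI, rule ccontr)
    fix p q assume "p \<noteq> q" "cell p \<inter> cell q \<noteq> {}"
    then obtain y where "y \<in> (\<lambda>t. int_vec p + t) ` ?Q" "y \<in> (\<lambda>t. int_vec q + t) ` ?Q"
      by (auto simp: cell_def simp del: image_iff)
    thus False using \<open>p \<noteq> q\<close> by (simp only: floor_cell)
  qed
  ultimately have "measure lebesgue S = (\<Sum>p\<in>F. measure lebesgue (cell p))"
    using measure_finite_Union[OF finF, of cell lebesgue] fmeasurableD[OF cell(1)]
      fmeasurableD2[OF cell(1)] by (simp add: image_subset_iff del: emeasure_completion)
  hence sumT: "\<bar>det M\<bar> = (\<Sum>p\<in>F. measure lebesgue (T p))" by (simp add: mS cell(2))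
  obtain t where t: "\<bar>det M\<bar> \<le> card {p\<in>F. t \<in> T p}"
  proof (rule ccontr)
    assume "\<not> thesis"
    hence less: "card {p\<in>F. t \<in> T p} < \<bar>det M\<bar>" for t using that not_le by blast
    \<comment> \<open>The largest integer below \<open>|det M|\<close>: the counts are integers, so they stay a definite
       amount below the average that they should have.\<close>
    define k where "k = \<lceil>\<bar>det M\<bar>\<rceil> - 1"
    have k: "card {p\<in>F. t \<in> T p} \<le> k" for t
      using less[of t] unfolding k_def by linarith
    have int: "integrable lebesgue (indicator A :: _ \<Rightarrow> real)" if "A \<in> lmeasurable" for A :: "(real ^ 'w::_) set"
      using that by (intro integrable_real_indicator) (auto simp: fmeasurable_def)
    have "\<bar>det M\<bar> = (\<integral>t. (\<Sum>p\<in>F. indicator (T p) t) \<partial>lebesgue)"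
      by (simp add: sumT int T)
    also have "\<dots> \<le> (\<integral>t. real_of_int k * indicator ?Q t \<partial>lebesgue)"
    proof (rule integral_mono)
      show "integrable lebesgue (\<lambda>t. real_of_int k * indicator ?Q t)"
        using int[OF unit_cube_lmeasurable] by simp
      fix t
      have "(\<Sum>p\<in>F. indicator (T p) t) = real (card {p\<in>F. t \<in> T p})"
        using finF by (simp add: indicator_def Collect_conj_eq flip: sum.inter_filter)
      also have "\<dots> \<le> real_of_int k * indicator ?Q t"
      proof (cases "t \<in> ?Q")
        case False
        hence "{p\<in>F. t \<in> T p} = {}" by (auto simp: T_def)
        hence "card {p\<in>F. t \<in> T p} = 0" by (simp only: card.empty)
        thus ?thesis using False by (simp only:) simp
      qed (use k[of t] in simp)
      finally show "(\<Sum>p\<in>F. indicator (T p) t) \<le> real_of_int k * indicator ?Q t" .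
    qed (use int T in simp)
    also have "\<dots> = k" by (simp add: measure_unit_cube)
    finally show False unfolding k_def by linarith
  qed
  define P where "P = {p\<in>F. t \<in> T p}"
  have "\<exists>x\<in>?Q. M *v x = t + int_vec p" if "p \<in> P" for p
    using that by (force simp: P_def T_def S_def algebra_simps)
  then obtain g where g: "\<And>p. p \<in> P \<Longrightarrow> g p \<in> ?Q" "\<And>p. p \<in> P \<Longrightarrow> M *v g p = t + int_vec p"
    by metis
  have "inj_on g P"
    by (rule inj_onI) (metis add_left_cancel g(2) int_vec_eq_iff)
  moreover have "\<exists>r. M *v (x - y) = int_vec r" if xy: "x \<in> g ` P" "y \<in> g ` P" for x y
  proof -
    obtain p q where "p \<in> P" "x = g p" "q \<in> P" "y = g q" using xy by blast
    hence "M *v (x - y) = (t + int_vec p) - (t + int_vec q)"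
      by (simp add: g(2) matrix_vector_mult_diff_distrib)
    also have "\<dots> = int_vec (p - q)" by (simp add: vec_eq_iff)
    finally have "M *v (x - y) = int_vec (p - q)" .
    thus ?thesis ..
  qed
  moreover have "finite P" using finF by (simp add: P_def)
  ultimately show ?thesis
    using that[of "g ` P"] t g(1) by (auto simp: card_image P_def[symmetric])
qed

text \<open>
  A copy of a finite type that carries a well-order, by enumeration. It transfers the
  previous lemma from ordered index types to arbitrary finite ones.
\<close>

typedef ('a::finite) ranked = "{..<CARD('a)}"
  by (rule exI[of _ 0]) simp

instantiation ranked :: (finite) linorder
begin

definition less_eq_ranked :: "'a ranked \<Rightarrow> 'a ranked \<Rightarrow> bool" where
  "less_eq_ranked x y \<longleftrightarrow> Rep_ranked x \<le> Rep_ranked y"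

definition less_ranked :: "'a ranked \<Rightarrow> 'a ranked \<Rightarrow> bool" where
  "less_ranked x y \<longleftrightarrow> Rep_ranked x < Rep_ranked y"

instance
  by standard (auto simp: less_eq_ranked_def less_ranked_def Rep_ranked_inject)

end

instance ranked :: (finite) finite
proof
  show "finite (UNIV :: 'a ranked set)"
    unfolding type_definition.univ[OF type_definition_ranked] by simp
qed

instance ranked :: (finite) wellorder
proof
  fix P :: "'a ranked \<Rightarrow> bool" and a
  assume step: "\<And>x. (\<And>y. y < x \<Longrightarrow> P y) \<Longrightarrow> P x"
  show "P a"
  proof (induction a rule: measure_induct_rule[of Rep_ranked])
    case (less x)
    show ?case by (rule step, rule less) (simp add: less_ranked_def)
  qed
qed

lemma card_ranked: "CARD('n::finite ranked) = CARD('n)"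
  using type_definition.card[OF type_definition_ranked] by simp

lemma det_reindex:
  fixes M :: "'a::comm_ring_1 ^ 'n ^ 'n" and h :: "'m::finite \<Rightarrow> 'n"
  assumes h: "bij h"
  shows "det (\<chi> i j. M $ h i $ h j) = det M"
proof -
  have inj: "inj_on h UNIV" using h by (rule bij_is_inj)
  have bij_perm: "bij_betw (map_permutation UNIV h) {p. p permutes UNIV} {p. p permutes UNIV}"
  proof (rule bij_betw_byWitness[where f' = "map_permutation UNIV (inv h)"])
    show "\<forall>p\<in>{p. p permutes UNIV}. map_permutation UNIV (inv h) (map_permutation UNIV h p) = p"
      using h by (auto intro!: map_permutation_compose_inv simp: bij_is_inj)
    show "\<forall>p\<in>{p. p permutes UNIV}. map_permutation UNIV h (map_permutation UNIV (inv h) p) = p"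
      using bij_imp_bij_inv[OF h] h
      by (auto intro!: map_permutation_compose_inv simp: surj_f_inv_f bij_is_surj)
  qed (use map_permutation_permutes[OF h] map_permutation_permutes[OF bij_imp_bij_inv[OF h]] in auto)
  have "det M = (\<Sum>p | p permutes (UNIV :: 'm set).
      of_int (sign (map_permutation UNIV h p)) * (\<Prod>i\<in>UNIV. M $ i $ map_permutation UNIV h p i))"
    unfolding det_def by (rule sum.reindex_bij_betw[OF bij_perm, symmetric])
  also have "\<dots> = (\<Sum>p | p permutes (UNIV :: 'm set). of_int (sign p) * (\<Prod>i\<in>UNIV. M $ h i $ h (p i)))"
  proof (intro sum.cong refl)
    fix p :: "'m \<Rightarrow> 'm" assume "p \<in> {p. p permutes UNIV}"
    moreover have "(\<Prod>i\<in>UNIV. M $ i $ map_permutation UNIV h p i) =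
        (\<Prod>i\<in>UNIV. M $ h i $ map_permutation UNIV h p (h i))"
      by (rule prod.reindex_bij_betw[OF h, symmetric])
    ultimately show "of_int (sign (map_permutation UNIV h p)) *
        (\<Prod>i\<in>UNIV. M $ i $ map_permutation UNIV h p i) =
        of_int (sign p) * (\<Prod>i\<in>UNIV. M $ h i $ h (p i))"
      using inj by (simp add: sign_map_permutation map_permutation_apply)
  qed
  finally show ?thesis by (simp add: det_def)
qed

text \<open>
  Renaming the coordinates along a bijection with an ordered index type affects neither the
  determinant nor the unit cube nor the integer vectors.
\<close>

lemma lattice_points_in_unit_cube:
  fixes M :: "real ^ 'n ^ 'n"
  obtains E where "finite E" "E \<subseteq> unit_cube" "\<bar>det M\<bar> \<le> card E"
    "\<And>x y. x \<in> E \<Longrightarrow> y \<in> E \<Longrightarrow> \<exists>p. M *v (x - y) = int_vec p"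
proof -
  obtain h :: "'n ranked \<Rightarrow> 'n" where h: "bij h"
    using finite_same_card_bij[of "UNIV :: 'n ranked set" "UNIV :: 'n set"] card_ranked by auto
  define N where "N = (\<chi> i j. M $ h i $ h j)"
  obtain E where E: "finite E" "E \<subseteq> unit_cube" "\<bar>det N\<bar> \<le> card E"
    "\<And>x y. x \<in> E \<Longrightarrow> y \<in> E \<Longrightarrow> \<exists>p. N *v (x - y) = int_vec p"
    using lattice_points_in_unit_cube_ordered[of N] by blast
  define \<phi> :: "real ^ 'n ranked \<Rightarrow> real ^ 'n" where "\<phi> x = (\<chi> a. x $ inv h a)" for x
  have "inj \<phi>"
  proof (rule injI)
    fix x y assume "\<phi> x = \<phi> y"
    hence "x $ inv h (h j) = y $ inv h (h j)" for j by (simp add: \<phi>_def vec_eq_iff)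
    thus "x = y" using h by (simp add: vec_eq_iff bij_is_inj)
  qed
  moreover have "\<exists>p. M *v (u - v) = int_vec p" if uv: "u \<in> \<phi> ` E" "v \<in> \<phi> ` E" for u v
  proof -
    obtain x y where xy: "x \<in> E" "y \<in> E" "u = \<phi> x" "v = \<phi> y" using uv by blast
    obtain p where p: "N *v (x - y) = int_vec p" using E(4) xy(1,2) by blast
    have "(\<Sum>b\<in>UNIV. M $ a $ b * (x - y) $ inv h b) =
        (\<Sum>j\<in>UNIV. M $ h (inv h a) $ h j * (x - y) $ j)" for a
      using sum.reindex_bij_betw[OF h, of "\<lambda>b. M $ a $ b * (x - y) $ inv h b"] h
      by (simp add: bij_is_inj bij_is_surj surj_f_inv_f)
    moreover have "u - v = \<phi> (x - y)" by (simp add: xy \<phi>_def vec_eq_iff)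
    ultimately have "M *v (u - v) = \<phi> (N *v (x - y))"
      by (simp add: \<phi>_def N_def vec_eq_iff matrix_vector_mult_def)
    also have "\<dots> = int_vec (\<chi> a. p $ inv h a)" by (simp add: p \<phi>_def vec_eq_iff)
    finally show ?thesis by blast
  qed
  moreover have "\<phi> ` E \<subseteq> unit_cube" using E(2) by (auto simp: \<phi>_def unit_cube_def)
  moreover have "card (\<phi> ` E) = card E" using \<open>inj \<phi>\<close> by (simp add: card_image inj_on_subset)
  moreover have "det N = det M" unfolding N_def by (rule det_reindex[OF h])
  ultimately show ?thesis using that[of "\<phi> ` E"] E(1,3) by simp
qed

section \<open>The invariant torus\<close>

abbreviation real_matrix :: "int ^ 'n ^ 'n \<Rightarrow> real ^ 'n ^ 'n" where
  "real_matrix A \<equiv> map_matrix of_int A"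

text \<open>
  The point of the compact torus with angles \<open>2 \<pi> x\<^sub>j\<close>, in homogeneous coordinates whose last entry
  is \<open>1\<close>.
\<close>

definition torus_vec :: "real ^ 'n \<Rightarrow> complex ^ ('n option)" where
  "torus_vec x = (\<chi> i. case i of None \<Rightarrow> 1 | Some j \<Rightarrow> cis (2 * pi * x $ j))"

definition torus_point :: "real ^ 'n \<Rightarrow> (complex ^ ('n option)) set" where
  "torus_point x = cline (torus_vec x)"

lemma torus_vec_nth [simp]:
  "torus_vec x $ None = 1" "torus_vec x $ Some j = cis (2 * pi * x $ j)"
  by (simp_all add: torus_vec_def)

lemma torus_vec_nth_nonzero: "torus_vec x $ i \<noteq> 0"
  by (cases i) simp_all

lemma torus_vec_nonzero: "torus_vec x \<noteq> 0"
  using torus_vec_nth_nonzero[of x None] by force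

lemma prod_cis: "finite I \<Longrightarrow> (\<Prod>i\<in>I. cis (f i)) = cis (\<Sum>i\<in>I. f i)"
  by (induction I rule: finite_induct) (simp_all add: cis_mult)

text \<open>
  In the affine chart the map raises \<open>cis (2 \<pi> x\<^sub>j)\<close> to integer powers and multiplies, which acts on the
  angles as the matrix \<open>A\<close>.
\<close>

lemma monomials_torus_vec:
  obtains c where "c \<noteq> 0" "monomials A (torus_vec x) = c *s torus_vec (real_matrix A *v x)"
proof
  let ?w = "monomials A (torus_vec x)"
  show nz: "?w $ None \<noteq> 0"
    by (simp add: monomials_def torus_vec_nth_nonzero)
  have "?w $ Some i / ?w $ None = torus_vec (real_matrix A *v x) $ Some i" for i
    by (simp add: monomials_affine torus_vec_nth_nonzero cis_power_int prod_cis
        matrix_vector_mult_def sum_distrib_left mult_ac)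
  hence "?w $ i = (?w $ None *s torus_vec (real_matrix A *v x)) $ i" for i
    using nz by (cases i) (simp_all add: field_simps)
  thus "?w = ?w $ None *s torus_vec (real_matrix A *v x)"
    unfolding vec_eq_iff by blast
qed

lemma monomial_map_torus_point:
  "monomial_map A (torus_point x) = Some (torus_point (real_matrix A *v x))"
proof -
  obtain c where "c \<noteq> 0" "monomials A (torus_vec x) = c *s torus_vec (real_matrix A *v x)"
    by (rule monomials_torus_vec)
  thus ?thesis
    by (simp add: torus_point_def monomial_map_cline torus_vec_nonzero cline_scale)
qed

lemma torus_point_in_domain: "torus_point x \<in> monomial_domain A"
proof -
  have "monomial_iter A N (torus_point x) = Some (torus_point (mat_pow (real_matrix A) N *v x))" for N
    by (induction N)
       (simp_all add: monomial_iter_def monomial_map_torus_point matrix_vector_mul_assoc)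
  thus ?thesis
    by (simp add: monomial_domain_def) (simp add: torus_point_def torus_vec_nonzero)
qed

lemma monomial_fun_funpow_torus_point:
  "(monomial_fun A ^^ k) (torus_point x) = torus_point (mat_pow (real_matrix A) k *v x)"
  by (induction k) (simp_all add: monomial_fun_def monomial_map_torus_point matrix_vector_mul_assoc)

lemma line_angle_torus_point:
  fixes x y :: "real ^ 'n"
  shows "line_angle (torus_point x) (torus_point y) =
    arccos (cmod (1 + (\<Sum>j\<in>UNIV. cis (2 * pi * (x $ j - y $ j)))) / (CARD('n) + 1))"
proof -
  have "norm (torus_vec z) * norm (torus_vec z) = CARD('n) + 1" for z :: "real ^ 'n"
    by (simp add: norm_vec_def L2_set_def UNIV_option_sum)
  moreover have "norm (torus_vec x) = norm (torus_vec y)"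
    by (simp add: norm_vec_def L2_set_def UNIV_option_sum)
  moreover have "hermitian_inner (torus_vec x) (torus_vec y) =
      1 + (\<Sum>j\<in>UNIV. cis (2 * pi * (x $ j - y $ j)))"
    by (simp add: hermitian_inner_def UNIV_option_sum cis_cnj cis_mult algebra_simps)
  ultimately show ?thesis
    by (simp add: torus_point_def line_angle_cline torus_vec_nonzero)
qed

lemma line_angle_torus_point_self: "line_angle (torus_point x) (torus_point x) = 0"
  for x :: "real ^ 'n"
proof -
  have "1 + complex_of_nat CARD('n) = complex_of_nat (Suc CARD('n))" by simp
  hence "cmod (1 + complex_of_nat CARD('n)) = 1 + real CARD('n)"
    by (metis norm_of_nat of_nat_Suc)
  thus ?thesis by (simp add: line_angle_torus_point add.commute)
qed

section \<open>Angle and distance on the torus\<close>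

lemma cos_pi_mult_nonneg:
  assumes "0 \<le> s" "s \<le> 1 / 2"
  shows "0 \<le> cos (pi * s)"
proof (rule cos_ge_zero)
  have "0 \<le> pi * s" using assms(1) by simp
  thus "- (pi / 2) \<le> pi * s" by (smt (verit) pi_half_ge_zero)
  show "pi * s \<le> pi / 2" using mult_left_mono[OF assms(2), of pi] by simp
qed

text \<open>
  Subtracting the nearest integer does not change \<open>|cos (\<pi> t)|\<close>, and the cosine decreases on
  \<open>[0, \<pi> / 2]\<close>.
\<close>

lemma near_int_of_cos_bound:
  assumes "0 \<le> \<delta>" "\<delta> \<le> 1 / 2" "cos (pi * \<delta>) \<le> \<bar>cos (pi * t)\<bar>"
  shows "\<bar>t - of_int (round t)\<bar> \<le> \<delta>"
proof -
  define s where "s = t - of_int (round t)"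
  have s: "\<bar>s\<bar> \<le> 1 / 2" using of_int_round_abs_le[of t] by (simp add: s_def abs_minus_commute)
  have "sin (pi * of_int (round t)) = 0" by (simp add: sin_times_pi_eq_0 mult.commute)
  hence "\<bar>cos (pi * of_int (round t))\<bar> = 1"
    using sin_cos_squared_add[of "pi * of_int (round t)"] by (simp add: power2_eq_1_iff abs_if)
  moreover have "cos (pi * t) = cos (pi * s) * cos (pi * of_int (round t))"
    using cos_add[of "pi * s" "pi * of_int (round t)"] \<open>sin _ = 0\<close>
    by (simp add: s_def algebra_simps)
  ultimately have "\<bar>cos (pi * t)\<bar> = \<bar>cos (pi * s)\<bar>" by (simp add: abs_mult)
  also have "\<bar>cos (pi * s)\<bar> = \<bar>cos (pi * \<bar>s\<bar>)\<bar>" by (simp add: abs_if)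
  also have "\<dots> = cos (pi * \<bar>s\<bar>)" using s by (intro abs_of_nonneg cos_pi_mult_nonneg) auto
  finally have "cos (pi * \<delta>) \<le> cos (pi * \<bar>s\<bar>)" using assms(3) by simp
  hence "pi * \<bar>s\<bar> \<le> pi * \<delta>"
    using assms s by (subst (asm) cos_mono_le_eq) (auto simp: field_simps)
  thus ?thesis by (simp add: s_def)
qed

lemma cmod_one_plus_cis: "cmod (1 + cis (2 * pi * t)) = 2 * \<bar>cos (pi * t)\<bar>"
proof -
  have "1 + cis (2 * pi * t) = cis (pi * t) * of_real (2 * cos (pi * t))"
    using cos_double_cos[of "pi * t"] sin_double[of "pi * t"]
    by (simp add: complex_eq_iff algebra_simps power2_eq_square)
  thus ?thesis by (simp add: norm_mult)
qed

text \<open>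
  With \<open>t = x - y\<close>, the cosine of the angle is \<open>|1 + \<Sum>\<^sub>j cis (2 \<pi> t\<^sub>j)| / (n + 1)\<close>, a sum of \<open>n + 1\<close>
  unit vectors. It is close to \<open>1\<close> only if each single \<open>|1 + cis (2 \<pi> t\<^sub>i)| = 2 |cos (\<pi> t\<^sub>i)|\<close> is
  close to \<open>2\<close>, the remaining \<open>n - 1\<close> summands contributing at most \<open>n - 1\<close>.
\<close>

lemma torus_points_close_imp_near_int:
  assumes "0 < \<delta>" "\<delta> \<le> 1 / 2"
  obtains \<epsilon> where "\<epsilon> > 0"
    "\<And>x y :: real ^ 'n. line_angle (torus_point x) (torus_point y) \<le> \<epsilon> \<Longrightarrow>
       \<exists>p. \<forall>i. \<bar>(x - y - int_vec p) $ i\<bar> \<le> \<delta>"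
proof
  define C where "C = cos (pi * \<delta>)"
  define m where "m = real CARD('n) + 1"
  \<comment> \<open>The value of the cosine of the angle below which some coordinate may be farther than \<open>\<delta>\<close>
     from the integers: it makes the final bound for \<open>|cos (\<pi> t\<^sub>i)|\<close> exactly \<open>cos (\<pi> \<delta>)\<close>.\<close>
  define a where "a = 1 - 2 * (1 - C) / m"
  have m: "m \<ge> 2" unfolding m_def using zero_less_card_finite[where 'a='n] by simp
  have "C < cos 0" unfolding C_def
    using assms by (intro cos_monotone_0_pi) (auto simp: field_simps)
  hence C1: "C < 1" by simp
  have C0: "0 \<le> C" unfolding C_def using assms by (intro cos_pi_mult_nonneg) auto
  have "2 * (1 - C) \<le> m" using m C0 unfolding right_diff_distrib by linarith
  hence a: "0 \<le> a" "a < 1" using m C1 by (auto simp: a_def field_simps)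
  show "arccos a > 0" using arccos_less_arccos[of a 1] a by simp
  fix x y :: "real ^ 'n"
  define t where "t i = x $ i - y $ i" for i
  let ?c = "\<lambda>i. cis (2 * pi * t i)"
  define q where "q = cmod (1 + (\<Sum>j\<in>UNIV. ?c j))"
  assume "line_angle (torus_point x) (torus_point y) \<le> arccos a"
  hence le: "arccos (q / m) \<le> arccos a"
    by (simp add: line_angle_torus_point t_def q_def m_def add.commute)
  have "q \<le> 1 + (\<Sum>j\<in>(UNIV :: 'n set). cmod (?c j))"
    unfolding q_def by (rule order_trans[OF norm_triangle_ineq]) (simp add: sum_norm_le del: norm_cis)
  hence "\<bar>q / m\<bar> \<le> 1" using m by (simp add: q_def m_def)
  hence "a \<le> q / m" using le a arccos_le_mono[of "q / m" a] by simp
  hence "a * m \<le> q" using m by (simp add: pos_le_divide_eq)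
  moreover have "a * m = m - 2 * (1 - C)" using m by (simp add: a_def field_simps)
  ultimately have q: "m - 2 * (1 - C) \<le> q" by simp
  have "\<bar>(x - y - int_vec (\<chi> i. round (t i))) $ i\<bar> \<le> \<delta>" for i
  proof -
    have "(\<Sum>j\<in>UNIV. ?c j) = ?c i + (\<Sum>j\<in>UNIV - {i}. ?c j)" by (rule sum.remove) auto
    hence "q \<le> cmod (1 + ?c i) + cmod (\<Sum>j\<in>UNIV - {i}. ?c j)"
      unfolding q_def by (metis add.assoc norm_triangle_ineq)
    also have "cmod (\<Sum>j\<in>UNIV - {i}. ?c j) \<le> (\<Sum>j\<in>UNIV - {i}. cmod (?c j))" by (rule norm_sum)
    also have "\<dots> = m - 2" by (simp add: m_def card_Diff_singleton)
    finally have "C \<le> \<bar>cos (pi * t i)\<bar>" using q by (simp add: cmod_one_plus_cis)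
    thus ?thesis using near_int_of_cos_bound[of \<delta> "t i"] assms by (simp add: C_def t_def)
  qed
  thus "\<exists>p. \<forall>i. \<bar>(x - y - int_vec p) $ i\<bar> \<le> \<delta>" by blast
qed

section \<open>Separated points on the torus\<close>

lemma real_matrix_mult_int_vec: "real_matrix B *v int_vec p = int_vec (B *v p)"
  by (simp add: vec_eq_iff matrix_vector_mult_def)

lemma abs_matrix_vector_mult_le:
  fixes B :: "real ^ 'n ^ 'm"
  assumes "\<And>i. \<bar>v $ i\<bar> \<le> \<delta>"
  shows "\<bar>(B *v v) $ i\<bar> \<le> (\<Sum>i\<in>UNIV. \<Sum>j\<in>UNIV. \<bar>B $ i $ j\<bar>) * \<delta>"
proof -
  have d: "0 \<le> \<delta>" using assms[of undefined] by linarith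
  have "\<bar>(B *v v) $ i\<bar> \<le> (\<Sum>j\<in>UNIV. \<bar>B $ i $ j * v $ j\<bar>)"
    by (simp add: matrix_vector_mult_def sum_abs)
  also have "\<dots> \<le> (\<Sum>j\<in>UNIV. \<bar>B $ i $ j\<bar>) * \<delta>"
    by (auto simp: sum_distrib_right abs_mult intro!: sum_mono mult_left_mono assms)
  also have "\<dots> \<le> (\<Sum>i\<in>UNIV. \<Sum>j\<in>UNIV. \<bar>B $ i $ j\<bar>) * \<delta>"
    using d by (intro mult_right_mono member_le_sum) (auto intro!: sum_nonneg)
  finally show ?thesis .
qed

lemma small_of_near_int:
  fixes p :: "int ^ 'n"
  assumes "\<And>i. \<bar>(u - int_vec p) $ i\<bar> \<le> \<delta>" "\<And>i. \<bar>u $ i\<bar> < 1 - \<delta>"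
  shows "p = 0"
proof -
  have "p $ i = 0" for i
    using assms(1)[of i] assms(2)[of i] by simp
  thus ?thesis by (simp add: vec_eq_iff)
qed

text \<open>
  The first bound on \<open>\<delta>\<close> says that \<open>B\<close> maps vectors with entries at most \<open>\<delta>\<close> to vectors so short that
  \<open>0\<close> is the only integer vector within \<open>\<delta>\<close>. So once the orbit of \<open>v = w - p\<close> starts small, being
  near the integers forces it to stay small. The second bound then makes \<open>2 v - B\<^sup>N v\<close> an integer
  vector with entries below \<open>1\<close>.
\<close>

lemma orbit_near_int_imp_int:
  fixes A :: "int ^ 'n ^ 'n"
  defines "B \<equiv> real_matrix A"
  assumes \<delta>: "(\<Sum>i\<in>UNIV. \<Sum>j\<in>UNIV. \<bar>B $ i $ j\<bar>) * \<delta> < 1 - \<delta>" "3 * \<delta> < 1"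
    and near: "\<And>k. k \<le> N \<Longrightarrow> \<exists>p. \<forall>i. \<bar>(mat_pow B k *v w - int_vec p) $ i\<bar> \<le> \<delta>"
    and lattice: "(mat 2 - mat_pow B N) *v w = int_vec q"
    and nonsing: "det (mat 2 - mat_pow B N) \<noteq> 0"
  shows "\<exists>p. w = int_vec p"
proof -
  obtain p where p: "\<And>i. \<bar>(w - int_vec p) $ i\<bar> \<le> \<delta>"
    using near[of 0] by auto
  define v where "v = w - int_vec p"
  have pow: "mat_pow B k = real_matrix (mat_pow A k)" for k
    by (simp add: B_def map_matrix_of_int_mat_pow)
  have small: "\<bar>(mat_pow B k *v v) $ i\<bar> \<le> \<delta>" if "k \<le> N" for k i
    using that
  proof (induction k arbitrary: i)
    case 0
    then show ?case using p by (simp add: v_def)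
  next
    case (Suc k)
    let ?u = "mat_pow B (Suc k) *v v"
    obtain r where r: "\<And>i. \<bar>(mat_pow B (Suc k) *v w - int_vec r) $ i\<bar> \<le> \<delta>"
      using near[OF Suc.prems] by blast
    define r' where "r' = r - mat_pow A (Suc k) *v p"
    have "?u - int_vec r' = mat_pow B (Suc k) *v w - int_vec r"
      unfolding v_def matrix_vector_mult_diff_distrib pow real_matrix_mult_int_vec
      by (simp add: r'_def vec_eq_iff)
    hence near': "\<bar>(?u - int_vec r') $ i\<bar> \<le> \<delta>" for i using r by simp
    have "\<bar>?u $ i\<bar> < 1 - \<delta>" for i
      using abs_matrix_vector_mult_le[of "mat_pow B k *v v" \<delta> B i] Suc \<delta>(1)
      by (simp add: matrix_vector_mul_assoc)
    hence "r' = 0" by (rule small_of_near_int[OF near'])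
    thus ?case using near' by simp
  qed
  let ?M = "mat 2 - mat_pow B N"
  have M: "?M = real_matrix (mat 2 - mat_pow A N)"
    by (simp add: pow map_matrix_of_int_diff map_matrix_of_int_mat)
  have M2: "?M *v v = 2 *\<^sub>R v - mat_pow B N *v v"
    by (simp add: vec_eq_iff matrix_vector_mult_def mat_def left_diff_distrib sum_subtractf
        if_distrib[of "\<lambda>a. a * _"] cong: if_cong)
  define s where "s = q - (mat 2 - mat_pow A N) *v p"
  have Mv: "?M *v v = int_vec s"
    unfolding v_def matrix_vector_mult_diff_distrib lattice unfolding M real_matrix_mult_int_vec
    by (simp add: s_def vec_eq_iff)
  have "s = 0"
  proof (rule small_of_near_int[of "?M *v v" s 0])
    show "\<bar>(?M *v v - int_vec s) $ i\<bar> \<le> 0" for i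
      by (simp add: Mv)
    show "\<bar>(?M *v v) $ i\<bar> < 1 - 0" for i
      using small[of 0 i] small[of N i] \<delta>(2) by (simp add: M2)
  qed
  hence "?M *v v = 0" using Mv by (simp add: vec_eq_iff)
  hence "v = 0"
    using nonsing by (metis invertible_det_nz invertible_left_inverse matrix_left_invertible_ker)
  thus ?thesis by (auto simp: v_def)
qed

text \<open>
  The separated set is the image of the lattice points for \<open>2 - B\<^sup>N\<close>. Their orbits have to be
  compared at the \<open>N + 1\<close> times \<open>0, \<dots>, N\<close>, whence \<open>Suc N\<close>. The constant \<open>\<epsilon>\<close> depends on \<open>A\<close>
  alone.
\<close>

lemma torus_sep_number_ge:
  fixes A :: "int ^ 'n ^ 'n"
  obtains \<epsilon> where "\<epsilon> > 0"
    "\<And>N. det (mat 2 - mat_pow (real_matrix A) N) \<noteq> 0 \<Longrightarrow>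
       \<exists>c. \<bar>det (mat 2 - mat_pow (real_matrix A) N)\<bar> \<le> real c \<and>
           enat c \<le> sep_number line_angle (monomial_fun A) (monomial_domain A) (Suc N) \<epsilon>"
proof -
  define B where "B = real_matrix A"
  define L where "L = (\<Sum>i\<in>UNIV. \<Sum>j\<in>UNIV. \<bar>B $ i $ j\<bar>)"
  \<comment> \<open>Any \<open>\<delta> < 1 / max 3 (L + 1)\<close> would do here.\<close>
  define \<delta> where "\<delta> = 1 / (L + 4)"
  have L: "0 \<le> L" unfolding L_def by (simp add: sum_nonneg)
  have \<delta>: "0 < \<delta>" "\<delta> \<le> 1 / 2" "L * \<delta> < 1 - \<delta>" "3 * \<delta> < 1"
    using L by (auto simp: \<delta>_def field_simps)
  obtain \<epsilon> where \<epsilon>: "\<epsilon> > 0"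
    "\<And>x y :: real ^ 'n. line_angle (torus_point x) (torus_point y) \<le> \<epsilon> \<Longrightarrow>
       \<exists>p. \<forall>i. \<bar>(x - y - int_vec p) $ i\<bar> \<le> \<delta>"
    using torus_points_close_imp_near_int[OF \<delta>(1,2)] by blast
  have "\<exists>c. \<bar>det (mat 2 - mat_pow B N)\<bar> \<le> real c \<and>
      enat c \<le> sep_number line_angle (monomial_fun A) (monomial_domain A) (Suc N) \<epsilon>"
    if nonsing: "det (mat 2 - mat_pow B N) \<noteq> 0" for N
  proof -
    let ?d = "bowen_dist line_angle (monomial_fun A) (Suc N)"
    obtain E where E: "finite E" "E \<subseteq> unit_cube" "\<bar>det (mat 2 - mat_pow B N)\<bar> \<le> card E"
      "\<And>x y. x \<in> E \<Longrightarrow> y \<in> E \<Longrightarrow> \<exists>p. (mat 2 - mat_pow B N) *v (x - y) = int_vec p"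
      using lattice_points_in_unit_cube[of "mat 2 - mat_pow B N"] by blast
    have sep: "x = y" if xy: "x \<in> E" "y \<in> E" and d: "?d (torus_point x) (torus_point y) \<le> \<epsilon>" for x y
    proof -
      have "\<exists>p. \<forall>i. \<bar>(mat_pow B k *v (x - y) - int_vec p) $ i\<bar> \<le> \<delta>" if "k \<le> N" for k
      proof -
        have "line_angle (torus_point (mat_pow B k *v x)) (torus_point (mat_pow B k *v y)) \<le>
            ?d (torus_point x) (torus_point y)"
          unfolding bowen_dist_def
          using that by (intro Max_ge) (auto simp: monomial_fun_funpow_torus_point B_def)
        hence "line_angle (torus_point (mat_pow B k *v x)) (torus_point (mat_pow B k *v y)) \<le> \<epsilon>"
          using d by linarith
        from \<epsilon>(2)[OF this] show ?thesis by (simp only: matrix_vector_mult_diff_distrib)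
      qed
      moreover obtain q where "(mat 2 - mat_pow B N) *v (x - y) = int_vec q"
        using E(4) xy by blast
      ultimately have "\<exists>p. x - y = int_vec p"
        using \<delta>(3,4) nonsing unfolding B_def L_def by (intro orbit_near_int_imp_int)
      then obtain p where p: "x - y = int_vec p" ..
      have "p = 0"
      proof (rule small_of_near_int[of "x - y" p 0])
        show "\<bar>(x - y - int_vec p) $ i\<bar> \<le> 0" for i by (simp add: p)
        have "x \<in> unit_cube" "y \<in> unit_cube" using xy E(2) by auto
        hence "0 \<le> x $ i" "x $ i < 1" "0 \<le> y $ i" "y $ i < 1" for i by (auto simp: unit_cube_def)
        thus "\<bar>(x - y) $ i\<bar> < 1 - 0" for i
          by (simp add: abs_less_iff) (smt (verit))
      qed
      thus "x = y" using p by (simp add: vec_eq_iff)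
    qed
    \<comment> \<open>Distinct lattice points have distinct images, since otherwise their images would be at Bowen
       distance \<open>0\<close>.\<close>
    have refl: "?d z z \<le> \<epsilon>" if "z = torus_point x" for z and x :: "real ^ 'n"
      using \<epsilon>(1) that unfolding bowen_dist_def
      by (subst Max_le_iff) (auto simp: monomial_fun_funpow_torus_point line_angle_torus_point_self)
    have "inj_on torus_point E"
      by (intro inj_onI sep) (auto intro: refl)
    hence "card (torus_point ` E) = card E" by (rule card_image)
    moreover have "separated line_angle (monomial_fun A) (monomial_domain A) (Suc N) \<epsilon> (torus_point ` E)"
      unfolding separated_def using torus_point_in_domain sep by (fastforce simp: not_le[symmetric])
    hence "enat (card (torus_point ` E)) \<le>
        sep_number line_angle (monomial_fun A) (monomial_domain A) (Suc N) \<epsilon>"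
      unfolding sep_number_def using E(1) by (intro SUP_upper) auto
    ultimately show ?thesis using E(3) by auto
  qed
  thus ?thesis using that \<epsilon>(1) by (simp add: B_def)
qed

section \<open>The entropy bound\<close>

lemma limsup_ge_of_subseq:
  fixes X :: "nat \<Rightarrow> ereal"
  assumes "strict_mono r" "\<forall>\<^sub>F m in sequentially. ereal (l m) \<le> X (r m)" "l \<longlonglongrightarrow> b"
  shows "ereal b \<le> limsup X"
proof -
  have "ereal b = limsup (\<lambda>m. ereal (l m))"
    using assms(3) by (intro lim_imp_Limsup[symmetric]) auto
  also have "\<dots> \<le> limsup (X \<circ> r)"
    using assms(2) by (intro Limsup_mono) (simp add: o_def)
  also have "\<dots> \<le> limsup X" by (rule limsup_subseq_mono[OF assms(1)])
  finally show ?thesis .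
qed

theorem theorem5p1:
  fixes A :: "int ^ 'n ^ 'n"
  assumes "det A \<noteq> 0"
  shows "monomial_entropy A \<ge>
    ereal (ln (cmod (\<Prod>\<mu> | eigenvalue (map_matrix of_int A) \<mu> \<and> cmod \<mu> > 1.
                       \<mu> ^ alg_multiplicity (map_matrix of_int A) \<mu>)))"
proof -
  let ?M = "map_matrix of_int A :: complex ^ 'n ^ 'n"
  let ?s = "\<lambda>N \<epsilon>. sep_number line_angle (monomial_fun A) (monomial_domain A) N \<epsilon>"
  define P where "P = cmod (\<Prod>\<mu> | eigenvalue ?M \<mu> \<and> cmod \<mu> > 1. \<mu> ^ alg_multiplicity ?M \<mu>)"
  define D where "D N = \<bar>det (mat 2 - mat_pow (real_matrix A) N)\<bar>" for N
  have P: "P > 0" by (auto simp: P_def finite_eigenvalues)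
  have D: "D N = cmod (det (mat 2 - mat_pow ?M N))" for N
  proof -
    let ?I = "mat 2 - mat_pow A N"
    have "mat 2 - mat_pow (real_matrix A) N = map_matrix of_int ?I"
      "mat 2 - mat_pow ?M N = map_matrix of_int ?I"
      by (simp_all add: map_matrix_of_int_diff map_matrix_of_int_mat map_matrix_of_int_mat_pow)
    thus ?thesis by (simp add: D_def det_map_matrix_of_int)
  qed
  obtain C where C: "C > 0" "\<forall>\<^sub>F m in sequentially. C * P ^ (2 ^ m) \<le> D (2 ^ m)"
    using det_two_minus_power_growth[of ?M] unfolding D P_def by blast
  obtain \<epsilon> where \<epsilon>: "\<epsilon> > 0"
    "\<And>N. D N \<noteq> 0 \<Longrightarrow> \<exists>c. D N \<le> real c \<and> enat c \<le> ?s (Suc N) \<epsilon>"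
    using torus_sep_number_ge[of A] unfolding D_def by (metis abs_eq_0)
  \<comment> \<open>The minorant of the growth rate at time \<open>2\<^sup>m + 1\<close>; the factor \<open>C\<close> and the shift by one disappear
     in the limit.\<close>
  define l where "l m = (ln C + 2 ^ m * ln P) / (2 ^ m + 1)" for m :: nat
  have two_power_nz: "(2::real) ^ m + 1 \<noteq> 0" for m
    by (smt (verit) zero_less_power)
  have "ereal (ln P) \<le> sep_growth line_angle (monomial_fun A) (monomial_domain A) \<epsilon>"
    unfolding sep_growth_def
  proof (rule limsup_ge_of_subseq[of "\<lambda>m. Suc (2 ^ m)" l])
    show "strict_mono (\<lambda>m. Suc (2 ^ m))" by (simp add: strict_mono_def)
    show "\<forall>\<^sub>F m in sequentially. ereal (l m) \<le>
        ln_enat (?s (Suc (2 ^ m)) \<epsilon>) / ereal (real (Suc (2 ^ m)))"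
      using C(2)
    proof (rule eventually_mono)
      fix m assume le: "C * P ^ (2 ^ m) \<le> D (2 ^ m)"
      have pos: "C * P ^ (2 ^ m) > 0" using C(1) P by simp
      then obtain c where c: "D (2 ^ m) \<le> real c" "enat c \<le> ?s (Suc (2 ^ m)) \<epsilon>"
        using \<epsilon>(2)[of "2 ^ m"] le by auto
      have "ln C + 2 ^ m * ln P = ln (C * P ^ (2 ^ m))"
        using C(1) P by (simp add: ln_mult ln_realpow)
      also have "\<dots> \<le> ln (real c)" using pos le c(1) by simp
      finally have "ereal (ln C + 2 ^ m * ln P) \<le> ln_enat (enat c)"
        using pos le c(1) by auto
      also have "\<dots> \<le> ln_enat (?s (Suc (2 ^ m)) \<epsilon>)" by (rule ln_enat_mono[OF c(2)])
      finally have "ereal (ln C + 2 ^ m * ln P) / ereal (real (Suc (2 ^ m))) \<le>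
          ln_enat (?s (Suc (2 ^ m)) \<epsilon>) / ereal (real (Suc (2 ^ m)))"
        by (rule ereal_divide_right_mono) (simp add: add_pos_pos)
      thus "ereal (l m) \<le> ln_enat (?s (Suc (2 ^ m)) \<epsilon>) / ereal (real (Suc (2 ^ m)))"
        using two_power_nz[of m] by (simp add: l_def add.commute)
    qed
    have "l = (\<lambda>m. ln P + (ln C - ln P) / (2 ^ m + 1))"
      using two_power_nz by (simp add: l_def fun_eq_iff field_simps)
    moreover have "filterlim (\<lambda>m. 2 ^ m + 1 :: real) at_infinity sequentially"
      by (rule tendsto_add_filterlim_at_infinity'[OF filterlim_realpow_sequentially_gt1 tendsto_const]) simp
    hence "(\<lambda>m. ln P + (ln C - ln P) / (2 ^ m + 1)) \<longlonglongrightarrow> ln P + 0"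
      by (intro tendsto_add tendsto_const tendsto_divide_0[OF tendsto_const])
    ultimately show "l \<longlonglongrightarrow> ln P" by simp
  qed
  also have "\<dots> \<le> monomial_entropy A"
    unfolding monomial_entropy_def bowen_entropy_eq_SUP using \<epsilon>(1) by (intro SUP_upper) simp
  finally show ?thesis by (simp only: P_def)
qed

end
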